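(* Let $l<r$ be positive integers, let $B_0,B_1\in\{0,1\}^{l\times r}$ satisfy $B_0+B_1=1^{l\times r}$ (the all-ones $l\times r$ matrix), let $M>1$, and let $H$ be the binary bi-adjacency matrix of the $(l,r)$-regular SC-LDPC protograph $\mathcal G=(\mathcal V\cup\mathcal C,\mathcal E)$ obtained by placing $M$ copies of $(B_0;B_1)$ on the diagonal (coupling with memory $1$, truncated after $M$ copies, all-zero rows removed). Let $\mathcal V$ be divided into $M$ sub-blocks, sub-block $m$ being the set of $r$ variable nodes (columns) of the $m$-th copy. If there are no two rows of the $2l\times r$ matrix $(B_0;B_1)$ that are all ones, then the local BP decoding thresholds satisfy $$\epsilon^*_m=0,\qquad 2\le m\le M-1 .$$ If, in addition, the partition of $1^{l\times r}$ into $B_0,B_1$ is done via the cutting-vector method, then also $\epsilon^*_1=\epsilon^*_M=0$.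
   Context: A protograph is a bipartite (multi)graph with variable nodes (VNs) and check nodes (CNs), represented by a bi-adjacency matrix $H$ with nonnegative integer entries: columns are VNs, rows are CNs, and $H_{i,j}$ is the number of edges between CN $i$ and VN $j$. Density evolution on the BEC$(\epsilon)$: each edge $e$ carries $x_\ell(e)$ (VN-to-CN) and $u_\ell(e)$ (CN-to-VN) with $x_{-1}=u_{-1}=1$ and, for $\ell\ge 0$, for an edge $e$ joining VN $v$ and CN $c$, $$u_\ell(e)=1-\prod_{e'\ni c,\,e'\ne e}(1-x_{\ell-1}(e')),\qquad x_\ell(e)=\epsilon\prod_{e'\ni v,\,e'\neq e}u_\ell(e'),$$ (empty products equal $1$), and $P_\ell(v,\epsilon)=\epsilon\prod_{e\ni v}u_\ell(e)$. The BP threshold is $\epsilon^*=\sup\{\epsilon\in[0,1]:\lim_{\ell\to\infty}P_\ell(v,\epsilon)=0\ \text{for every VN } v\}$. $(B_0;B_1)$ denotes vertical concatenation. The coupled matrix $H$ has $(M+1)$ block rows (each of $l$ rows) and $M$ block columns (each of $r$ columns): block column $m$ has $B_0$ in block row $m$, $B_1$ in block row $m+1$, and zeros elsewhere; all-zero rows are then removed. Local checks and local thresholds: let $\mathcal V_m$ be the VNs of sub-block $m$. CN $i$ is a local check of sub-block $m$ if $\{j: H_{i,j}=1\}\subseteq\mathcal V_m$; the set of these is $\mathcal C_m$. The local protograph $\mathcal G_m$ is the subgraph of $\mathcal G$ consisting of $\mathcal V_m\cup\mathcal C_m$ and all edges between $\mathcal V_m$ and $\mathcal C_m$. The local threshold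 is $\epsilon^*_m=\epsilon^*(\mathcal G_m)$. Cutting-vector method: there are integers $1\le\xi_1<\xi_2<\cdots<\xi_l\le r$ such that $B_0(i,j)=1$ if $j\le\xi_i$ and $B_0(i,j)=0$ otherwise, and $B_1=1^{l\times r}-B_0$. *)

theory Defs
  imports Complex_Main "Jordan_Normal_Form.DL_Submatrix"
begin

section \<open>Protographs\<close>

text \<open>A bipartite multigraph: \<open>nedges G i j\<close> is the number of parallel edges between the check
  node \<open>i\<close> and the variable node \<open>j\<close>.\<close>

record protograph =
  vns :: "nat set"
  cns :: "nat set"
  nedges :: "nat \<Rightarrow> nat \<Rightarrow> nat"

text \<open>An edge \<open>(i, j, k)\<close> is the \<open>k\<close>-th of the parallel edges joining check node \<open>i\<close> and
  variable node \<open>j\<close>.\<close>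

type_synonym edge = "nat \<times> nat \<times> nat"

definition edges :: "protograph \<Rightarrow> edge set" where
  "edges G = {(i, j, k). i \<in> cns G \<and> j \<in> vns G \<and> k < nedges G i j}"

definition cn_of :: "edge \<Rightarrow> nat" where
  "cn_of e = fst e"

definition vn_of :: "edge \<Rightarrow> nat" where
  "vn_of e = fst (snd e)"

definition protograph_of_mat :: "nat mat \<Rightarrow> protograph" where
  "protograph_of_mat H =
     \<lparr>vns = {..<dim_col H}, cns = {..<dim_row H}, nedges = (\<lambda>i j. H $$ (i, j))\<rparr>"


section \<open>Density evolution on the binary erasure channel\<close>

text \<open>The iteration counter is shifted by one: argument \<open>n\<close> stands for iteration \<open>n - 1\<close>, so that
  argument \<open>0\<close> is the initialisation \<open>x\<^sub>-\<^sub>1 = u\<^sub>-\<^sub>1 = 1\<close>.\<close>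

function de_u :: "protograph \<Rightarrow> real \<Rightarrow> nat \<Rightarrow> edge \<Rightarrow> real"
  and de_x :: "protograph \<Rightarrow> real \<Rightarrow> nat \<Rightarrow> edge \<Rightarrow> real" where
  "de_u G \<epsilon> 0 e = 1"
| "de_u G \<epsilon> (Suc n) e =
     1 - (\<Prod>e' \<in> {e' \<in> edges G. cn_of e' = cn_of e \<and> e' \<noteq> e}. 1 - de_x G \<epsilon> n e')"
| "de_x G \<epsilon> 0 e = 1"
| "de_x G \<epsilon> (Suc n) e =
     \<epsilon> * (\<Prod>e' \<in> {e' \<in> edges G. vn_of e' = vn_of e \<and> e' \<noteq> e}. de_u G \<epsilon> (Suc n) e')"
  by pat_completeness auto
termination
  by (relation "measure (\<lambda>s. case s of Inl (G, \<epsilon>, n, e) \<Rightarrow> 2 * n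
                                     | Inr (G, \<epsilon>, n, e) \<Rightarrow> 2 * n + 1)") auto

text \<open>In contrast, \<open>t \<ge> 0\<close> is the actual iteration number here.\<close>

definition erasure_prob :: "protograph \<Rightarrow> real \<Rightarrow> nat \<Rightarrow> nat \<Rightarrow> real" where
  "erasure_prob G \<epsilon> t v = \<epsilon> * (\<Prod>e \<in> {e \<in> edges G. vn_of e = v}. de_u G \<epsilon> (Suc t) e)"

definition bp_threshold :: "protograph \<Rightarrow> real" where
  "bp_threshold G =
     Sup {\<epsilon>. 0 \<le> \<epsilon> \<and> \<epsilon> \<le> 1 \<and> (\<forall>v \<in> vns G. (\<lambda>t. erasure_prob G \<epsilon> t v) \<longlonglongrightarrow> 0)}"


section \<open>Spatially coupled protographs with memory one\<close>

definition all_ones_mat :: "nat \<Rightarrow> nat \<Rightarrow> nat mat" where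
  "all_ones_mat nr nc = mat nr nc (\<lambda>_. 1)"

definition coupled_mat_raw :: "nat mat \<Rightarrow> nat mat \<Rightarrow> nat \<Rightarrow> nat mat" where
  "coupled_mat_raw B0 B1 M =
     (let l = dim_row B0; r = dim_col B0 in
      mat ((M + 1) * l) (M * r) (\<lambda>(i, j).
        if i div l = j div r then B0 $$ (i mod l, j mod r)
        else if i div l = j div r + 1 then B1 $$ (i mod l, j mod r)
        else 0))"

definition remove_zero_rows :: "nat mat \<Rightarrow> nat mat" where
  "remove_zero_rows A = submatrix A {i. i < dim_row A \<and> row A i \<noteq> 0\<^sub>v (dim_col A)} UNIV"

definition coupled_mat :: "nat mat \<Rightarrow> nat mat \<Rightarrow> nat \<Rightarrow> nat mat" where
  "coupled_mat B0 B1 M = remove_zero_rows (coupled_mat_raw B0 B1 M)"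

text \<open>Sub-blocks are numbered from \<open>1\<close>, whereas matrix indices start at \<open>0\<close>.\<close>

definition sub_block :: "nat \<Rightarrow> nat \<Rightarrow> nat set" where
  "sub_block r m = {(m - 1) * r ..< m * r}"

definition local_checks :: "nat mat \<Rightarrow> nat set \<Rightarrow> nat set" where
  "local_checks H V = {i. i < dim_row H \<and> {j. j < dim_col H \<and> H $$ (i, j) = 1} \<subseteq> V}"

definition subprotograph :: "protograph \<Rightarrow> nat set \<Rightarrow> nat set \<Rightarrow> protograph" where
  "subprotograph G V C = \<lparr>vns = vns G \<inter> V, cns = cns G \<inter> C, nedges = nedges G\<rparr>"

definition local_protograph :: "nat mat \<Rightarrow> nat \<Rightarrow> nat \<Rightarrow> protograph" where
  "local_protograph H r m =
     subprotograph (protograph_of_mat H) (sub_block r m) (local_checks H (sub_block r m))"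

definition local_threshold :: "nat mat \<Rightarrow> nat \<Rightarrow> nat \<Rightarrow> real" where
  "local_threshold H r m = bp_threshold (local_protograph H r m)"

text \<open>The entries of the cutting vector \<open>\<xi>\<close> are numbered from \<open>1\<close>.\<close>

definition cutting_vector_partition :: "nat \<Rightarrow> nat \<Rightarrow> nat mat \<Rightarrow> nat mat \<Rightarrow> bool" where
  "cutting_vector_partition l r B0 B1 \<longleftrightarrow>
     (\<exists>\<xi> :: nat \<Rightarrow> nat.
        strict_mono_on {1..l} \<xi> \<and> (\<forall>i \<in> {1..l}. 1 \<le> \<xi> i \<and> \<xi> i \<le> r) \<and>
        B0 = mat l r (\<lambda>(i, j). if j + 1 \<le> \<xi> (i + 1) then 1 else 0)) \<and>
     B1 = all_ones_mat l r - B0"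

end

theory Submission
  imports Defs
begin

text \<open>
  Suppose that every check node \<open>c\<close> of a protograph can be given a private variable node \<open>p c\<close>
  next to it so that, in a suitable ranking of the checks, all other checks next to \<open>p c\<close> rank
  strictly below \<open>c\<close>. By induction on the rank, the message from \<open>p c\<close> to \<open>c\<close> stays above a
  positive constant: the factors \<open>u\<close> it is made of come from checks \<open>c'\<close> of smaller rank, and each
  of those is at least the message from \<open>p c'\<close> to \<open>c'\<close>. A variable node outside the image of
  \<open>p\<close> then receives only messages bounded away from zero, so it never becomes decodable, whatever
  \<open>\<epsilon> > 0\<close> is.

  A middle sub-block has at most one local check, and \<open>r \<ge> 2\<close> variable nodes. With a cutting vector
  the local checks of the first sub-block are nested initial segments of the variable nodes, and \<open>p\<close>
  picks their last elements; in the last sub-block they are final segments, and \<open>p\<close> picks their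
  first elements. There are at most \<open>l < r\<close> picks, so some variable node is left over.
\<close>

section \<open>Density evolution\<close>

lemma de_bounds:
  assumes "0 \<le> \<epsilon>" "\<epsilon> \<le> 1"
  shows "(\<forall>e. de_u G \<epsilon> n e \<in> {0..1}) \<and> (\<forall>e. de_x G \<epsilon> n e \<in> {0..1})"
proof (induction n)
  case (Suc n)
  have u: "de_u G \<epsilon> (Suc n) e \<in> {0..1}" for e
    using Suc by (auto intro!: prod_nonneg prod_le_1)
  have "de_x G \<epsilon> (Suc n) e \<in> {0..1}" for e
  proof -
    have "0 \<le> (\<Prod>e' \<in> {e' \<in> edges G. vn_of e' = vn_of e \<and> e' \<noteq> e}. de_u G \<epsilon> (Suc n) e')"
      "(\<Prod>e' \<in> {e' \<in> edges G. vn_of e' = vn_of e \<and> e' \<noteq> e}. de_u G \<epsilon> (Suc n) e') \<le> 1"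
      using u by (auto intro!: prod_nonneg prod_le_1 simp del: de_u.simps)
    then show ?thesis
      using assms by (simp add: mult_le_one del: de_u.simps)
  qed
  with u show ?case by blast
qed simp

text \<open>One factor \<open>1 - x\<close> already bounds the product at the check, since the
  others lie in [0,1]: a single unreliable message keeps the outputs on all other edges
  unreliable.\<close>

lemma de_x_le_de_u:
  assumes "0 \<le> \<epsilon>" "\<epsilon> \<le> 1" "finite (edges G)"
    and "e' \<in> edges G" "cn_of e' = cn_of e" "e' \<noteq> e"
  shows "de_x G \<epsilon> n e' \<le> de_u G \<epsilon> (Suc n) e"
proof -
  let ?A = "{e' \<in> edges G. cn_of e' = cn_of e \<and> e' \<noteq> e}"
  have x: "0 \<le> de_x G \<epsilon> n d" "de_x G \<epsilon> n d \<le> 1" for d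
    using de_bounds[OF assms(1,2), of G n] unfolding atLeastAtMost_iff by blast+
  have "(\<Prod>d\<in>?A. 1 - de_x G \<epsilon> n d) = (1 - de_x G \<epsilon> n e') * (\<Prod>d\<in>?A - {e'}. 1 - de_x G \<epsilon> n d)"
    using assms by (intro prod.remove) auto
  also have "\<dots> \<le> 1 - de_x G \<epsilon> n e'"
    using x by (intro mult_left_le prod_le_1) auto
  finally show ?thesis by simp
qed

text \<open>The bounds of finitely many factors multiply to a bound still independent of
  \<open>n\<close>; this uniformity is what survives the limit over the iterations.\<close>

lemma prod_uniform_lower_bound:
  fixes f :: "nat \<Rightarrow> 'a \<Rightarrow> real"
  assumes "finite A" and "\<And>a. a \<in> A \<Longrightarrow> \<exists>d>0. \<forall>n. d \<le> f n a"
  shows "\<exists>d>0. \<forall>n. d \<le> (\<Prod>a\<in>A. f n a)"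
  using assms
proof (induction A rule: finite_induct)
  case empty
  show ?case by (intro exI[of _ 1]) simp
next
  case (insert a A)
  then obtain d d' where "d > 0" "\<forall>n. d \<le> f n a" "d' > 0" "\<forall>n. d' \<le> (\<Prod>a\<in>A. f n a)"
    by auto metis
  then show ?case
    using insert.hyps by (intro exI[of _ "d * d'"]) (auto intro: mult_mono' simp: less_imp_le)
qed

lemma finite_edges:
  assumes "finite (cns G)" "finite (vns G)"
  shows "finite (edges G)"
proof -
  have "edges G = (SIGMA i : cns G. SIGMA j : vns G. {..<nedges G i j})"
    by (auto simp: edges_def)
  then show ?thesis using assms by simp
qed

section \<open>Private variable nodes force a vanishing threshold\<close>

lemma erasure_prob_not_tendsto_0:
  fixes p rank :: "nat \<Rightarrow> nat"
  assumes \<epsilon>: "0 < \<epsilon>" "\<epsilon> \<le> 1" and fin: "finite (cns G)" "finite (vns G)"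
    and p: "\<And>c. c \<in> cns G \<Longrightarrow> p c \<in> vns G \<and> nedges G c (p c) = 1"
    and rank: "\<And>c c'. c \<in> cns G \<Longrightarrow> c' \<in> cns G \<Longrightarrow> c' \<noteq> c \<Longrightarrow> nedges G c' (p c) \<noteq> 0
      \<Longrightarrow> rank c' < rank c"
    and v: "v \<notin> p ` cns G"
  shows "\<not> (\<lambda>t. erasure_prob G \<epsilon> t v) \<longlonglongrightarrow> 0"
proof -
  note finE = finite_edges[OF fin]
  let ?e = "\<lambda>c. (c, p c, 0)"
  have e_edge: "?e c \<in> edges G" if "c \<in> cns G" for c
    using p[OF that] that by (simp add: edges_def)
  have u_bound: "\<exists>d>0. \<forall>n. d \<le> de_u G \<epsilon> (Suc n) e"
    if c: "cn_of e = c" "c \<in> cns G" "?e c \<noteq> e" and d: "\<exists>d>0. \<forall>n. d \<le> de_x G \<epsilon> n (?e c)" for e c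
  proof -
    have "de_x G \<epsilon> n (?e c) \<le> de_u G \<epsilon> (Suc n) e" for n
      using \<epsilon> c e_edge by (intro de_x_le_de_u finE) (auto simp: cn_of_def)
    with d show ?thesis by (meson order_trans)
  qed
  have x_bound: "\<exists>d>0. \<forall>n. d \<le> de_x G \<epsilon> n (?e c)" if "c \<in> cns G" for c
    using that
  proof (induction "rank c" arbitrary: c rule: less_induct)
    case less
    let ?A = "{e' \<in> edges G. vn_of e' = vn_of (?e c) \<and> e' \<noteq> ?e c}"
    have "\<exists>d>0. \<forall>n. d \<le> de_u G \<epsilon> (Suc n) e'" if e': "e' \<in> ?A" for e'
    proof -
      obtain c' k where [simp]: "e' = (c', p c, k)" and k: "k < nedges G c' (p c)"
        and c': "c' \<in> cns G" and ne: "(c', k) \<noteq> (c, 0)"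
        using e' by (cases e') (auto simp: edges_def vn_of_def)
      \<comment> \<open>A single edge, of index 0, joins \<open>c\<close> and \<open>p c\<close>, so
        any further edge at \<open>p c\<close> leads to another check.\<close>
      have "c' \<noteq> c"
        using k ne p[OF less.prems] by auto
      with k have lt: "rank c' < rank c"
        using rank[OF less.prems c'] by simp
      \<comment> \<open>Otherwise \<open>c\<close> would be next to \<open>p c'\<close> and rank
        below \<open>c'\<close>. Hence \<open>e'\<close> is not the private edge of
        \<open>c'\<close>, whose message therefore enters \<open>de_u\<close> on
        \<open>e'\<close>.\<close>
      have "p c' \<noteq> p c"
        using rank[OF c' less.prems] \<open>c' \<noteq> c\<close> p[OF less.prems] lt by auto
      then show ?thesis
        using c' less.hyps[OF lt c'] by (intro u_bound[of _ c']) (auto simp: cn_of_def)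
    qed
    then obtain d where d: "d > 0" "\<And>n. d \<le> (\<Prod>e'\<in>?A. de_u G \<epsilon> (Suc n) e')"
      using prod_uniform_lower_bound[of ?A "\<lambda>n. de_u G \<epsilon> (Suc n)"] finE by auto
    \<comment> \<open>The minimum with 1 covers the initial value at \<open>n = 0\<close>.\<close>
    have "min 1 (\<epsilon> * d) \<le> de_x G \<epsilon> n (?e c)" for n
    proof (cases n)
      case (Suc m)
      have "\<epsilon> * d \<le> de_x G \<epsilon> (Suc m) (?e c)"
        unfolding de_x.simps using d(2)[of m] \<epsilon> by (intro mult_left_mono) auto
      then show ?thesis using Suc by simp
    qed simp
    then show ?case
      using d \<epsilon> by (intro exI[of _ "min 1 (\<epsilon> * d)"]) auto
  qed
  let ?A = "{e \<in> edges G. vn_of e = v}"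
  have "\<exists>d>0. \<forall>n. d \<le> de_u G \<epsilon> (Suc n) e" if "e \<in> ?A" for e
  proof -
    have "cn_of e \<in> cns G"
      using that by (auto simp: edges_def cn_of_def)
    \<comment> \<open>As \<open>v\<close> is private to no check, each edge at \<open>v\<close>
      differs from the private edge of its check.\<close>
    moreover from this have "?e (cn_of e) \<noteq> e"
      using that v by (cases e) (auto simp: vn_of_def cn_of_def)
    ultimately show ?thesis
      using x_bound by (intro u_bound) auto
  qed
  then obtain d where d: "d > 0" "\<And>n. d \<le> (\<Prod>e\<in>?A. de_u G \<epsilon> (Suc n) e)"
    using prod_uniform_lower_bound[of ?A "\<lambda>n. de_u G \<epsilon> (Suc n)"] finE by auto
  have "\<epsilon> * d \<le> erasure_prob G \<epsilon> t v" for t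
    unfolding erasure_prob_def using d(2)[of t] \<epsilon> by (intro mult_left_mono) auto
  then have "\<epsilon> * d \<le> 0" if "(\<lambda>t. erasure_prob G \<epsilon> t v) \<longlonglongrightarrow> 0"
    using LIMSEQ_le_const[OF that] by auto
  then show ?thesis
    using \<epsilon> d(1) by (auto simp: mult_le_0_iff)
qed

text \<open>Every positive \<epsilon> fails at \<open>v\<close>, while 0 succeeds because \<epsilon>
  is a factor of the erasure probability. The supremum is thus over \<open>{0}\<close>, in
  particular not over the empty set.\<close>

lemma bp_threshold_eq_0:
  fixes p rank :: "nat \<Rightarrow> nat"
  assumes "finite (cns G)" "finite (vns G)"
    and "\<And>c. c \<in> cns G \<Longrightarrow> p c \<in> vns G \<and> nedges G c (p c) = 1"
    and "\<And>c c'. c \<in> cns G \<Longrightarrow> c' \<in> cns G \<Longrightarrow> c' \<noteq> c \<Longrightarrow> nedges G c' (p c) \<noteq> 0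
      \<Longrightarrow> rank c' < rank c"
    and "v \<in> vns G - p ` cns G"
  shows "bp_threshold G = 0"
proof -
  have "\<epsilon> = 0" if "0 \<le> \<epsilon>" "\<epsilon> \<le> 1" "\<forall>v\<in>vns G. (\<lambda>t. erasure_prob G \<epsilon> t v) \<longlonglongrightarrow> 0" for \<epsilon>
    using erasure_prob_not_tendsto_0[of \<epsilon> G p rank v] that assms by force
  then have "{\<epsilon>. 0 \<le> \<epsilon> \<and> \<epsilon> \<le> 1 \<and> (\<forall>v\<in>vns G. (\<lambda>t. erasure_prob G \<epsilon> t v) \<longlonglongrightarrow> 0)} = {0}"
    by (auto simp: erasure_prob_def)
  then show ?thesis
    by (simp add: bp_threshold_def)
qed


section \<open>Local checks of the coupled matrix\<close>

text \<open>The criterion in block coordinates: \<open>p\<close> and \<open>b\<close> are column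
  offsets inside the sub-block, whose columns start at \<open>k * r\<close>.\<close>

lemma local_threshold_eq_0:
  fixes p rank :: "nat \<Rightarrow> nat"
  assumes "dim_col H = M * r" "k < M"
    and p: "\<And>c. c \<in> local_checks H (sub_block r (Suc k)) \<Longrightarrow> p c < r \<and> H $$ (c, k * r + p c) = 1"
    and rank: "\<And>c c'. c \<in> local_checks H (sub_block r (Suc k))
      \<Longrightarrow> c' \<in> local_checks H (sub_block r (Suc k)) \<Longrightarrow> c' \<noteq> c
      \<Longrightarrow> H $$ (c', k * r + p c) \<noteq> 0 \<Longrightarrow> rank c' < rank c"
    and b: "b < r" "b \<notin> p ` local_checks H (sub_block r (Suc k))"
  shows "local_threshold H r (Suc k) = 0"
proof -
  let ?G = "local_protograph H r (Suc k)"
  have "Suc k * r \<le> M * r"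
    using assms(2) by (intro mult_right_mono) auto
  then have vns: "vns ?G = (+) (k * r) ` {..<r}"
    using assms(1) by (simp add: local_protograph_def subprotograph_def protograph_of_mat_def
        sub_block_def lessThan_atLeast0 add.commute)
  have cns: "cns ?G = local_checks H (sub_block r (Suc k))"
    by (auto simp: local_protograph_def subprotograph_def protograph_of_mat_def local_checks_def)
  have nedges: "nedges ?G i j = H $$ (i, j)" for i j
    by (simp add: local_protograph_def subprotograph_def protograph_of_mat_def)
  have "finite (cns ?G)"
    unfolding cns local_checks_def by simp
  then show ?thesis
    unfolding local_threshold_def using p rank b
    by (intro bp_threshold_eq_0[of _ "\<lambda>c. k * r + p c" rank "k * r + b"])
      (auto simp: vns nedges cns)
qed

text \<open>Row \<open>i\<close> of the coupled matrix is row \<open>a i\<close> of its block row \<open>q i\<close>.\<close>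

lemma coupled_mat_rows:
  fixes B0 B1 :: "nat mat"
  assumes B: "B0 \<in> carrier_mat l r" "B1 \<in> carrier_mat l r" and "H = coupled_mat B0 B1 M"
  obtains q a :: "nat \<Rightarrow> nat"
  where "dim_col H = M * r"
    and "inj_on (\<lambda>i. (q i, a i)) {..<dim_row H}"
    and "\<And>i. i < dim_row H \<Longrightarrow> a i < l"
    and "\<And>i s b. i < dim_row H \<Longrightarrow> s < M \<Longrightarrow> b < r \<Longrightarrow> H $$ (i, s * r + b) =
      (if q i = s then B0 $$ (a i, b) else if q i = Suc s then B1 $$ (a i, b) else 0)"
    and "\<And>i. i < dim_row H \<Longrightarrow> \<exists>s<M. \<exists>b<r. H $$ (i, s * r + b) \<noteq> 0"
proof -
  define A where "A = coupled_mat_raw B0 B1 M"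
  define S where "S = {i. i < dim_row A \<and> row A i \<noteq> 0\<^sub>v (dim_col A)}"
  have A: "A \<in> carrier_mat ((M + 1) * l) (M * r)"
    using B by (simp add: A_def coupled_mat_raw_def Let_def)
  have HS: "H = submatrix A S UNIV"
    by (simp add: assms(3) coupled_mat_def remove_zero_rows_def A_def S_def)
  have row_H: "dim_row H = card S"
    unfolding HS dim_submatrix by (rule arg_cong[of _ _ card]) (auto simp: S_def)
  have col_H: "dim_col H = M * r"
    using A unfolding HS dim_submatrix by simp
  have pick: "pick S i \<in> S" if "i < dim_row H" for i
    using that pick_in_set_le row_H by simp
  \<comment> \<open>\<open>submatrix\<close> renumbers the kept rows by the increasing enumeration
    \<open>pick S\<close>, so distinct rows of \<open>H\<close> keep distinct block
    coordinates.\<close>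
  have pick_inj: "inj_on (pick S) {..<dim_row H}"
    by (intro linorder_inj_onI) (auto simp: row_H dest!: pick_mono_le[of _ S])
  have idx: "H $$ (i, j) = A $$ (pick S i, j)" if "i < dim_row H" "j < M * r" for i j
    using that A unfolding HS by (simp add: submatrix_def pick_UNIV)
  have col_lt: "s * r + b < M * r" if "s < M" "b < r" for s b
  proof -
    have "Suc s * r \<le> M * r" using that by (intro mult_right_mono) auto
    with that show ?thesis by simp
  qed
  show ?thesis
  proof (rule that[of "\<lambda>i. pick S i div l" "\<lambda>i. pick S i mod l"])
    show "inj_on (\<lambda>i. (pick S i div l, pick S i mod l)) {..<dim_row H}"
      by (rule inj_onI) (metis prod.inject div_mult_mod_eq inj_onD pick_inj)
    fix i assume i: "i < dim_row H"
    have lt: "pick S i < (M + 1) * l"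
      using pick[OF i] A by (simp add: S_def)
    then show "pick S i mod l < l"
      by (cases "l = 0") auto
    show "H $$ (i, s * r + b) = (if pick S i div l = s then B0 $$ (pick S i mod l, b)
        else if pick S i div l = Suc s then B1 $$ (pick S i mod l, b) else 0)"
      if "s < M" "b < r" for s b
      using idx[OF i col_lt[OF that]] lt col_lt[OF that] that B
      by (simp add: A_def coupled_mat_raw_def Let_def)
    obtain j where j: "j < M * r" "A $$ (pick S i, j) \<noteq> 0"
      using pick[OF i] A by (auto simp: S_def vec_eq_iff)
    then have "j div r < M" "j mod r < r"
      by (cases "r = 0"; auto simp: less_mult_imp_div_less)+
    then show "\<exists>s<M. \<exists>b<r. H $$ (i, s * r + b) \<noteq> 0"
      using j idx[OF i j(1)] by (intro exI[of _ "j div r"] exI[of _ "j mod r"] conjI) auto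
  qed (rule col_H)
qed

text \<open>Block row \<open>k\<close> also meets block column \<open>k - 1\<close>, through
  \<open>B1\<close>, and block row \<open>Suc k\<close> meets block column \<open>Suc k\<close>,
  through \<open>B0\<close>. A local check vanishes there, so by complementarity its own part is all
  ones. At an end of the chain this neighbour is missing; a row of \<open>B1\<close> is then only
  known to be nonzero, because zero rows were removed.\<close>

lemma coupled_mat_local_checks:
  fixes B0 B1 :: "nat mat"
  assumes B: "B0 \<in> carrier_mat l r" "B1 \<in> carrier_mat l r"
    and sum: "\<forall>a<l. \<forall>b<r. B0 $$ (a, b) + B1 $$ (a, b) = 1"
    and H: "H = coupled_mat B0 B1 M" and k: "k < M"
  obtains q a :: "nat \<Rightarrow> nat"
  where "dim_col H = M * r"
    and "inj_on (\<lambda>i. (q i, a i)) (local_checks H (sub_block r (Suc k)))"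
    and "\<forall>i \<in> local_checks H (sub_block r (Suc k)). a i < l"
    and "\<forall>i \<in> local_checks H (sub_block r (Suc k)).
      q i = k \<and> (\<forall>b<r. H $$ (i, k * r + b) = B0 $$ (a i, b)) \<and>
        (0 < k \<longrightarrow> (\<forall>b<r. B0 $$ (a i, b) = 1)) \<or>
      q i = Suc k \<and> (\<forall>b<r. H $$ (i, k * r + b) = B1 $$ (a i, b)) \<and>
        (\<exists>b<r. B1 $$ (a i, b) = 1) \<and> (Suc k < M \<longrightarrow> (\<forall>b<r. B1 $$ (a i, b) = 1))"
proof -
  let ?C = "local_checks H (sub_block r (Suc k))"
  obtain q a where col: "dim_col H = M * r"
    and inj: "inj_on (\<lambda>i. (q i, a i)) {..<dim_row H}"
    and a: "\<And>i. i < dim_row H \<Longrightarrow> a i < l"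
    and idx: "\<And>i s b. i < dim_row H \<Longrightarrow> s < M \<Longrightarrow> b < r \<Longrightarrow> H $$ (i, s * r + b) =
      (if q i = s then B0 $$ (a i, b) else if q i = Suc s then B1 $$ (a i, b) else 0)"
    and nz: "\<And>i. i < dim_row H \<Longrightarrow> \<exists>s<M. \<exists>b<r. H $$ (i, s * r + b) \<noteq> 0"
    by (rule coupled_mat_rows[OF B H]) (rule that; blast)
  show ?thesis
  proof (rule that[OF col]; (rule ballI)?)
    show "inj_on (\<lambda>i. (q i, a i)) ?C"
      using inj by (rule inj_on_subset) (auto simp: local_checks_def)
    fix i assume "i \<in> ?C"
    then have i: "i < dim_row H"
      and loc: "\<And>j. j < M * r \<Longrightarrow> H $$ (i, j) = 1 \<Longrightarrow> k * r \<le> j \<and> j < Suc k * r"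
      by (auto simp: local_checks_def sub_block_def col)
    show "a i < l" using a[OF i] .
    have sum_i: "B0 $$ (a i, b) + B1 $$ (a i, b) = 1" if "b < r" for b
      using sum a[OF i] that by blast
    have block: "s = k" if "s < M" "b < r" "H $$ (i, s * r + b) = 1" for s b
    proof -
      have "Suc s * r \<le> M * r" using that by (intro mult_right_mono) auto
      then have "k * r \<le> s * r + b" "s * r + b < Suc k * r"
        using loc[OF _ that(3)] that by auto
      then have "(s * r + b) div r = k"
        by (intro div_nat_eqI) (auto simp: mult.commute)
      then show ?thesis using that by simp
    qed
    obtain s b where sb: "s < M" "b < r" "H $$ (i, s * r + b) \<noteq> 0"
      using nz[OF i] by blast
    \<comment> \<open>Locality speaks only of entries equal to 1; natural numbers with sum 1 are 0
      or 1, so a nonzero entry qualifies.\<close>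
    have "H $$ (i, s * r + b) = 1"
      using sb idx[OF i sb(1,2)] sum_i[OF sb(2)] by (auto split: if_splits)
    with block sb have [simp]: "s = k" by blast
    have "q i = k \<or> q i = Suc k"
      using sb idx[OF i sb(1,2)] by (auto split: if_splits)
    then show "q i = k \<and> (\<forall>b<r. H $$ (i, k * r + b) = B0 $$ (a i, b)) \<and>
        (0 < k \<longrightarrow> (\<forall>b<r. B0 $$ (a i, b) = 1)) \<or>
      q i = Suc k \<and> (\<forall>b<r. H $$ (i, k * r + b) = B1 $$ (a i, b)) \<and>
        (\<exists>b<r. B1 $$ (a i, b) = 1) \<and> (Suc k < M \<longrightarrow> (\<forall>b<r. B1 $$ (a i, b) = 1))"
    proof
      assume q: "q i = k"
      have "B0 $$ (a i, b) = 1" if "0 < k" "b < r" for b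
      proof -
        have "H $$ (i, (k - 1) * r + b) = B1 $$ (a i, b)"
          using idx[OF i, of "k - 1" b] that k q by (cases k) simp_all
        then have "B1 $$ (a i, b) \<noteq> 1"
          using block[of "k - 1" b] that k by (cases k) auto
        then show ?thesis using sum_i[OF that(2)] by linarith
      qed
      then show ?thesis using q idx[OF i k] by auto
    next
      assume q: "q i = Suc k"
      have "B1 $$ (a i, b) = 1" if "Suc k < M" "b < r" for b
      proof -
        have "H $$ (i, Suc k * r + b) = B0 $$ (a i, b)"
          using idx[OF i that] q by simp
        then have "B0 $$ (a i, b) \<noteq> 1"
          using block[OF that] by auto
        then show ?thesis using sum_i[OF that(2)] by linarith
      qed
      moreover have "B1 $$ (a i, b) = 1"
        using sb(3) idx[OF i k sb(2)] sum_i[OF sb(2)] q by auto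
      ultimately show ?thesis using q idx[OF i k] sb(2) by auto
    qed
  qed
qed

text \<open>Pigeonhole, supplying the variable node that is private to no check.\<close>

lemma ex_less_not_in_image:
  fixes f :: "nat \<Rightarrow> nat"
  assumes "l < r" "P \<subseteq> f ` {..<l}"
  obtains b where "b < r" "b \<notin> P"
proof -
  have "finite P"
    using assms(2) finite_subset by blast
  then have "\<not> {..<r} \<subseteq> P"
    using surj_card_le[OF _ assms(2)] card_mono[of P "{..<r}"] assms(1) by auto
  then show ?thesis
    using that by blast
qed

section \<open>Middle sub-blocks\<close>

text \<open>Neighbours on both sides force each local check to be an all-ones row of the stacked
  matrix, and distinct checks give distinct rows. So there is at most one check.\<close>

lemma local_threshold_middle:
  fixes B0 B1 :: "nat mat"
  assumes B: "B0 \<in> carrier_mat l r" "B1 \<in> carrier_mat l r"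
    and sum: "\<forall>a<l. \<forall>b<r. B0 $$ (a, b) + B1 $$ (a, b) = 1"
    and H: "H = coupled_mat B0 B1 M"
    and mid: "0 < k" "Suc k < M" and r: "1 < r"
    and all_ones: "\<not> (\<exists>i < 2 * l. \<exists>j < 2 * l. i \<noteq> j \<and>
      row (B0 @\<^sub>r B1) i = vec r (\<lambda>_. 1) \<and> row (B0 @\<^sub>r B1) j = vec r (\<lambda>_. 1))"
  shows "local_threshold H r (Suc k) = 0"
proof -
  have k: "k < M" using mid(2) by simp
  let ?C = "local_checks H (sub_block r (Suc k))"
  obtain q a where col: "dim_col H = M * r"
    and inj: "inj_on (\<lambda>i. (q i, a i)) ?C"
    and a0: "\<forall>i\<in>?C. a i < l"
    and C0: "\<forall>i\<in>?C.
      q i = k \<and> (\<forall>b<r. H $$ (i, k * r + b) = B0 $$ (a i, b)) \<and>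
        (0 < k \<longrightarrow> (\<forall>b<r. B0 $$ (a i, b) = 1)) \<or>
      q i = Suc k \<and> (\<forall>b<r. H $$ (i, k * r + b) = B1 $$ (a i, b)) \<and>
        (\<exists>b<r. B1 $$ (a i, b) = 1) \<and> (Suc k < M \<longrightarrow> (\<forall>b<r. B1 $$ (a i, b) = 1))"
    by (rule coupled_mat_local_checks[OF B sum H k]) (rule that)
  note a = bspec[OF a0] and C = bspec[OF C0]
  \<comment> \<open>Position in the stacked matrix, where the rows of \<open>B1\<close> follow the
    \<open>l\<close> rows of \<open>B0\<close>; \<open>a i < l\<close> keeps the halves
    apart.\<close>
  define R where "R i = (if q i = k then a i else l + a i)" for i
  have R: "R i < 2 * l \<and> row (B0 @\<^sub>r B1) (R i) = vec r (\<lambda>_. 1)" if "i \<in> ?C" for i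
    using C[OF that] a[OF that] B mid by (auto simp: R_def append_rows_def vec_eq_iff)
  have unique: "i = j" if "i \<in> ?C" "j \<in> ?C" for i j
  proof -
    have "R i = R j"
      using R that all_ones by blast
    then have "(q i, a i) = (q j, a j)"
      using C[OF that(1)] C[OF that(2)] a[OF that(1)] a[OF that(2)]
      by (auto simp: R_def split: if_splits)
    then show ?thesis using inj that by (simp add: inj_on_def)
  qed
  have ones: "H $$ (i, k * r + b) = 1" if "i \<in> ?C" "b < r" for i b
    using C[OF that(1)] that(2) mid by auto
  \<comment> \<open>Column 0 is private to the only possible check and column 1 is left over; the
    ranking condition is vacuous.\<close>
  show ?thesis
    using k r ones[of _ 0] unique
    by (intro local_threshold_eq_0[OF col, where p = "\<lambda>_. 0" and rank = "\<lambda>_. 0" and b = 1])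
      auto
qed

section \<open>Cutting vectors\<close>

text \<open>\<open>f\<close> is the cutting vector re-indexed from 0, so that \<open>f a\<close> is
  the length of the run of ones in row \<open>a\<close> of \<open>B0\<close>.\<close>

lemma cutting_vector_partitionE:
  assumes "cutting_vector_partition l r B0 B1"
  obtains f :: "nat \<Rightarrow> nat" where "inj_on f {..<l}" "\<forall>a<l. 0 < f a \<and> f a \<le> r"
    "\<forall>a<l. \<forall>b<r. B0 $$ (a, b) = (if b < f a then 1 else 0)"
proof -
  obtain \<xi> :: "nat \<Rightarrow> nat" where mono: "strict_mono_on {1..l} \<xi>"
    and \<xi>: "\<forall>i\<in>{1..l}. 1 \<le> \<xi> i \<and> \<xi> i \<le> r"
    and B0: "B0 = mat l r (\<lambda>(i, j). if j + 1 \<le> \<xi> (i + 1) then 1 else 0)"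
    using assms unfolding cutting_vector_partition_def by blast
  show ?thesis
  proof (rule that[of "\<lambda>a. \<xi> (Suc a)"])
    show "inj_on (\<lambda>a. \<xi> (Suc a)) {..<l}"
    proof (rule inj_onI)
      fix a b assume "a \<in> {..<l}" "b \<in> {..<l}" "\<xi> (Suc a) = \<xi> (Suc b)"
      then show "a = b"
        using inj_onD[OF strict_mono_on_imp_inj_on[OF mono], of "Suc a" "Suc b"] by simp
    qed
    show "\<forall>a<l. 0 < \<xi> (Suc a) \<and> \<xi> (Suc a) \<le> r"
    proof (intro allI impI)
      fix a assume "a < l"
      then show "0 < \<xi> (Suc a) \<and> \<xi> (Suc a) \<le> r"
        using bspec[OF \<xi>, of "Suc a"] by simp
    qed
    show "\<forall>a<l. \<forall>b<r. B0 $$ (a, b) = (if b < \<xi> (Suc a) then 1 else 0)"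
      by (simp add: B0 Suc_le_eq)
  qed
qed

section \<open>The two end sub-blocks\<close>

text \<open>All local checks here come from \<open>B0\<close>. A longer initial segment contains the
  last column of a shorter one and never conversely, so \<open>r - f (a i)\<close> is a suitable
  rank.\<close>

lemma local_threshold_first:
  fixes B0 B1 :: "nat mat"
  assumes B: "B0 \<in> carrier_mat l r" "B1 \<in> carrier_mat l r"
    and sum: "\<forall>a<l. \<forall>b<r. B0 $$ (a, b) + B1 $$ (a, b) = 1"
    and H: "H = coupled_mat B0 B1 M"
    and "l < r"
    and f_inj: "inj_on f {..<l}" and f_range: "\<forall>a<l. 0 < f a \<and> f a \<le> r"
    and B0: "\<forall>a<l. \<forall>b<r. B0 $$ (a, b) = (if b < f a then 1 else 0)"
    and "1 < M"
  shows "local_threshold H r 1 = 0"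
proof -
  have M0: "0 < M" using \<open>1 < M\<close> by simp
  have B1: "\<forall>a<l. \<forall>b<r. B1 $$ (a, b) = (if b < f a then 0 else 1)"
    using sum B0 by fastforce
  let ?C = "local_checks H (sub_block r (Suc 0))"
  obtain q a where col: "dim_col H = M * r"
    and inj: "inj_on (\<lambda>i. (q i, a i)) ?C"
    and a0: "\<forall>i\<in>?C. a i < l"
    and C0: "\<forall>i\<in>?C.
      q i = 0 \<and> (\<forall>b<r. H $$ (i, 0 * r + b) = B0 $$ (a i, b)) \<and>
        ((0 :: nat) < 0 \<longrightarrow> (\<forall>b<r. B0 $$ (a i, b) = 1)) \<or>
      q i = Suc 0 \<and> (\<forall>b<r. H $$ (i, 0 * r + b) = B1 $$ (a i, b)) \<and>
        (\<exists>b<r. B1 $$ (a i, b) = 1) \<and> (Suc 0 < M \<longrightarrow> (\<forall>b<r. B1 $$ (a i, b) = 1))"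
    by (rule coupled_mat_local_checks[OF B sum H M0]) (rule that)
  note a = bspec[OF a0] and C = bspec[OF C0]
  have row: "q i = 0" "\<And>b. b < r \<Longrightarrow> H $$ (i, b) = (if b < f (a i) then 1 else 0)"
    if "i \<in> ?C" for i
  proof -
    \<comment> \<open>Every row of \<open>B0\<close> has a one in column 0, so no row of
      \<open>B1\<close> is all ones, as \<open>1 < M\<close> would demand of a local check in block
      row 1.\<close>
    have "B1 $$ (a i, 0) \<noteq> 1"
      using B1[rule_format, OF a[OF that], of 0] f_range[rule_format, OF a[OF that]] \<open>l < r\<close> by simp
    then show "q i = 0" "\<And>b. b < r \<Longrightarrow> H $$ (i, b) = (if b < f (a i) then 1 else 0)"
      using C[OF that] B0[rule_format, OF a[OF that]] \<open>l < r\<close> \<open>1 < M\<close> by auto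
  qed
  let ?p = "\<lambda>i. f (a i) - 1"
  obtain b where b: "b < r" "b \<notin> ?p ` ?C"
    by (rule ex_less_not_in_image[OF \<open>l < r\<close>, of "?p ` ?C" "\<lambda>a. f a - 1"])
      (auto dest: a)
  have p: "?p i < r \<and> H $$ (i, ?p i) = 1" if "i \<in> ?C" for i
    using f_range[rule_format, OF a[OF that]] row(2)[OF that, of "?p i"] by auto
  have rank: "r - f (a j) < r - f (a i)"
    if "i \<in> ?C" "j \<in> ?C" "j \<noteq> i" "H $$ (j, ?p i) \<noteq> 0" for i j
  proof -
    \<comment> \<open>Block row and row index identify a check, and all local checks share block row
      0.\<close>
    have "a j \<noteq> a i"
      using inj_onD[OF inj _ that(2,1)] that(3) row(1)[OF that(1)] row(1)[OF that(2)] by auto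
    then have "f (a j) \<noteq> f (a i)"
      using inj_onD[OF f_inj] a that by auto
    moreover have "f (a i) - 1 < f (a j)"
      using that(4) row(2)[OF that(2), of "?p i"] p[OF that(1)] by (auto split: if_splits)
    ultimately show ?thesis
      using f_range[rule_format, OF a[OF that(2)]] by auto
  qed
  show ?thesis
    unfolding One_nat_def using \<open>1 < M\<close> p rank b
    by (intro local_threshold_eq_0[OF col, where p = ?p and rank = "\<lambda>i. r - f (a i)"]) auto
qed

text \<open>Local checks in block row \<open>k\<close> are full rows of \<open>B0\<close>, those in
  block row \<open>Suc k\<close> nonzero rows of \<open>B1\<close>; all are final segments. An
  earlier start gives a larger segment, so the first column serves both as private node and as
  rank.\<close>

lemma local_threshold_last:
  fixes B0 B1 :: "nat mat"
  assumes B: "B0 \<in> carrier_mat l r" "B1 \<in> carrier_mat l r"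
    and sum: "\<forall>a<l. \<forall>b<r. B0 $$ (a, b) + B1 $$ (a, b) = 1"
    and H: "H = coupled_mat B0 B1 (Suc k)"
    and "l < r"
    and f_inj: "inj_on f {..<l}" and f_range: "\<forall>a<l. 0 < f a \<and> f a \<le> r"
    and B0: "\<forall>a<l. \<forall>b<r. B0 $$ (a, b) = (if b < f a then 1 else 0)"
    and "0 < k"
  shows "local_threshold H r (Suc k) = 0"
proof -
  have k: "k < Suc k" by simp
  have B1: "\<forall>a<l. \<forall>b<r. B1 $$ (a, b) = (if b < f a then 0 else 1)"
    using sum B0 by fastforce
  let ?C = "local_checks H (sub_block r (Suc k))"
  obtain q a where col: "dim_col H = Suc k * r"
    and inj: "inj_on (\<lambda>i. (q i, a i)) ?C"
    and a0: "\<forall>i\<in>?C. a i < l"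
    and C0: "\<forall>i\<in>?C.
      q i = k \<and> (\<forall>b<r. H $$ (i, k * r + b) = B0 $$ (a i, b)) \<and>
        (0 < k \<longrightarrow> (\<forall>b<r. B0 $$ (a i, b) = 1)) \<or>
      q i = Suc k \<and> (\<forall>b<r. H $$ (i, k * r + b) = B1 $$ (a i, b)) \<and>
        (\<exists>b<r. B1 $$ (a i, b) = 1) \<and> (Suc k < Suc k \<longrightarrow> (\<forall>b<r. B1 $$ (a i, b) = 1))"
    by (rule coupled_mat_local_checks[OF B sum H k]) (rule that)
  note a = bspec[OF a0] and C = bspec[OF C0]
  \<comment> \<open>A check of full length \<open>r\<close> is a row of \<open>B0\<close>, starting at column \<open>0 = r mod r\<close>.\<close>
  let ?p = "\<lambda>i. f (a i) mod r"
  have q: "q i = (if f (a i) = r then k else Suc k)"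
    and H_idx: "\<And>b. b < r \<Longrightarrow> H $$ (i, k * r + b) = (if ?p i \<le> b then 1 else 0)"
    if "i \<in> ?C" for i
  proof -
    note range = f_range[rule_format, OF a[OF that]] and B0_i = B0[rule_format, OF a[OF that]]
      and B1_i = B1[rule_format, OF a[OF that]]
    have "q i = (if f (a i) = r then k else Suc k) \<and>
      (\<forall>b<r. H $$ (i, k * r + b) = (if ?p i \<le> b then 1 else 0))"
      using C[OF that]
    proof (elim disjE conjE)
      assume *: "q i = k" "\<forall>b<r. H $$ (i, k * r + b) = B0 $$ (a i, b)"
        "0 < k \<longrightarrow> (\<forall>b<r. B0 $$ (a i, b) = 1)"
      have "B0 $$ (a i, r - 1) = 1"
        using *(3) \<open>0 < k\<close> \<open>l < r\<close> by simp
      moreover have "r - 1 < r"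
        using \<open>l < r\<close> by linarith
      ultimately have "r - 1 < f (a i)"
        using B0_i by (metis zero_neq_one)
      with range have "f (a i) = r"
        by linarith
      then show ?thesis using * \<open>0 < k\<close> by simp
    next
      assume *: "q i = Suc k" "\<forall>b<r. H $$ (i, k * r + b) = B1 $$ (a i, b)"
        "\<exists>b<r. B1 $$ (a i, b) = 1"
      then obtain b where "b < r" "B1 $$ (a i, b) = 1" by blast
      \<comment> \<open>A nonzero entry of \<open>B1\<close> excludes length \<open>r\<close>, so
        \<open>mod r\<close> leaves the length unchanged.\<close>
      then have "f (a i) < r"
        using B1_i by (metis not_less order_le_less_trans zero_neq_one)
      then show ?thesis using *(1,2) B1_i by simp
    qed
    then show "q i = (if f (a i) = r then k else Suc k)"
      "\<And>b. b < r \<Longrightarrow> H $$ (i, k * r + b) = (if ?p i \<le> b then 1 else 0)"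
      by blast+
  qed
  obtain b where b: "b < r" "b \<notin> ?p ` ?C"
    by (rule ex_less_not_in_image[OF \<open>l < r\<close>, of "?p ` ?C" "\<lambda>a. f a mod r"])
      (auto dest: a)
  have p: "?p i < r \<and> H $$ (i, k * r + ?p i) = 1" if "i \<in> ?C" for i
    using H_idx[OF that, of "?p i"] \<open>l < r\<close> by simp
  have rank: "?p j < ?p i"
    if "i \<in> ?C" "j \<in> ?C" "j \<noteq> i" "H $$ (j, k * r + ?p i) \<noteq> 0" for i j
  proof -
    \<comment> \<open>Equal lengths would give equal \<open>a\<close> and, as \<open>q\<close>
      depends on the length alone, equal block rows.\<close>
    have "f (a j) \<noteq> f (a i)"
    proof
      assume eq: "f (a j) = f (a i)"
      then have "a j = a i" using inj_onD[OF f_inj] a that by auto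
      with eq show False
        using inj_onD[OF inj _ that(2,1)] that(3) q[OF that(1)] q[OF that(2)] by auto
    qed
    \<comment> \<open>Reduction mod \<open>r\<close> is injective on lengths from 1 to
      \<open>r\<close>: only \<open>r\<close> goes to 0.\<close>
    then have "?p j \<noteq> ?p i"
      using f_range[rule_format, OF a[OF that(1)]] f_range[rule_format, OF a[OF that(2)]]
      by (cases "f (a j) = r"; cases "f (a i) = r") auto
    moreover have "?p j \<le> ?p i"
      using that(4) H_idx[OF that(2), of "?p i"] p[OF that(1)] by (auto split: if_splits)
    ultimately show ?thesis by simp
  qed
  show ?thesis
    using p rank b k
    by (intro local_threshold_eq_0[OF col, where p = ?p and rank = ?p]) auto
qed

theorem theorem1:
  fixes l r M :: nat and B0 B1 H :: "nat mat"
  assumes "0 < l" and "l < r"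
    and "B0 \<in> carrier_mat l r" and "B1 \<in> carrier_mat l r"
    and "elements_mat B0 \<subseteq> {0, 1}" and "elements_mat B1 \<subseteq> {0, 1}"
    and "B0 + B1 = all_ones_mat l r"
    and "M > 1"
    and "H = coupled_mat B0 B1 M"
    and "\<not> (\<exists>i < 2 * l. \<exists>j < 2 * l. i \<noteq> j \<and>
           row (B0 @\<^sub>r B1) i = vec r (\<lambda>_. 1) \<and> row (B0 @\<^sub>r B1) j = vec r (\<lambda>_. 1))"
  shows "(\<forall>m. 2 \<le> m \<and> m \<le> M - 1 \<longrightarrow> local_threshold H r m = 0) \<and>
         (cutting_vector_partition l r B0 B1 \<longrightarrow>
            local_threshold H r 1 = 0 \<and> local_threshold H r M = 0)"
proof (intro conjI allI impI)
  note B = \<open>B0 \<in> carrier_mat l r\<close> \<open>B1 \<in> carrier_mat l r\<close>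
  note H = \<open>H = coupled_mat B0 B1 M\<close>
  have sum: "\<forall>a<l. \<forall>b<r. B0 $$ (a, b) + B1 $$ (a, b) = 1"
  proof (intro allI impI)
    fix a b assume "a < l" "b < r"
    then show "B0 $$ (a, b) + B1 $$ (a, b) = 1"
      using arg_cong[OF assms(7), of "\<lambda>A. A $$ (a, b)"] B by (simp add: all_ones_mat_def)
  qed
  show "local_threshold H r m = 0" if "2 \<le> m \<and> m \<le> M - 1" for m
  proof -
    \<comment> \<open>Sub-block \<open>m\<close> has 0-based position \<open>m - 1\<close>, the form
      in which the middle case is stated.\<close>
    have m: "0 < m - 1" "Suc (m - 1) < M" "1 < r" "Suc (m - 1) = m"
      using that \<open>0 < l\<close> \<open>l < r\<close> by linarith+
    show ?thesis
      using local_threshold_middle[OF B sum H m(1-3) assms(10)] unfolding m(4) .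
  qed
  assume "cutting_vector_partition l r B0 B1"
  then obtain f where f: "inj_on f {..<l}" "\<forall>a<l. 0 < f a \<and> f a \<le> r"
    "\<forall>a<l. \<forall>b<r. B0 $$ (a, b) = (if b < f a then 1 else 0)"
    by (rule cutting_vector_partitionE)
  show "local_threshold H r 1 = 0"
    by (rule local_threshold_first[OF B sum H \<open>l < r\<close> f \<open>M > 1\<close>])
  obtain k where k: "M = Suc k" "0 < k"
    using \<open>M > 1\<close> by (cases M) auto
  show "local_threshold H r M = 0"
    unfolding k(1) by (rule local_threshold_last[OF B sum H[unfolded k(1)] \<open>l < r\<close> f k(2)])
qed

end
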